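(* Suppose $f(x,\theta)$ is continuously differentiable in $x$ for all $\theta\in\Theta$ and $g$ is continuously differentiable. Suppose: $\|\nabla_x f(x_1,\theta)-\nabla_x f(x_2,\theta)\|\le G_{f,x}\|x_1-x_2\|$ for all $x_1,x_2\in X$, $\theta\in\Theta$; $\nabla_\theta g$ is Lipschitz continuous with constant $G_g$; $X$ and $\Theta$ are compact; $\|\nabla_x f(x,\theta_1)-\nabla_x f(x,\theta_2)\|\le G_{f,\theta}\|\theta_1-\theta_2\|$ for all $\theta_1,\theta_2\in\Theta$, $x\in X$; the solution set $\Theta^*=\operatorname{argmin}_{\theta\in\Theta}g(\theta)$ is weak sharp; and there is a constant $M_{f,\theta}$ such that $\|\nabla_x f(x,\theta)-\nabla_x f(x,\theta^* )\|\le M_{f,\theta}\,\mathrm{dist}(\theta,\Theta^* )$ for all $\theta\in\Theta$, $\theta^*\in\Theta^*$, $x\in X$. Let $\{\gamma_{g,k}\}$ be a diminishing nonnegative sequence with $\sum_{k=1}^\infty\gamma_{g,k}=\infty$ and $\sum_{k=1}^\infty\gamma_{g,k}^2<\infty$, and let $\gamma_{f,k}=\gamma_{g,k}$ for all $k>0$. Let $\{(x_k,\theta_k)\}$ be generated by the joint gradient scheme. Then, as $k\to\infty$, $\{x_k\}$ converges to a point in $X^*=\operatorname{argmin}_{x\in X}f(x,\theta^* )$ (where $\theta^*\in\Theta^*$) and $\{\theta_k\}$ converges to a point in $\Theta^*$.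
   Context: $X\subseteq\mathbb{R}^n$ and $\Theta\subseteq\mathbb{R}^m$ are nonempty closed convex sets, $f:X\times\Theta\to\mathbb{R}$ is convex in $x$ for every $\theta\in\Theta$, and $g:\mathbb{R}^m\to\mathbb{R}$ is convex. $\Pi_Y$ denotes Euclidean projection onto $Y$. $\Theta^*$ is weak sharp if there is $\alpha>0$ with $g(\theta)-g(\theta^* )\ge\alpha\,\mathrm{dist}(\theta,\Theta^* )$ for all $\theta\in\Theta$ and $\theta^*\in\Theta^*$, where $\mathrm{dist}(\theta,\Theta^* )=\min_{\theta^*\in\Theta^*}\|\theta-\theta^*\|$. "Diminishing" means tending to $0$. Under the stated hypotheses $\nabla_x f(x,\cdot)$ takes the same value at all points of $\Theta^*$, so $X^*$ does not depend on the choice of $\theta^*\in\Theta^*$. The joint gradient scheme, given $x_0\in X$, $\theta_0\in\Theta$ and steplengths $\{\gamma_{f,k}\},\{\gamma_{g,k}\}$, is: for all $k\ge0$, $x_{k+1}=\Pi_X(x_k-\gamma_{f,k}\nabla_x f(x_k,\theta_k))$ and $\theta_{k+1}=\Pi_\Theta(\theta_k-\gamma_{g,k}\nabla_\theta g(\theta_k))$. *)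

theory Defs
  imports "HOL-Analysis.Analysis"
begin

definition argmin_on :: "'a set \<Rightarrow> ('a \<Rightarrow> real) \<Rightarrow> 'a set" where
  "argmin_on S h = {x. is_arg_min h (\<lambda>y. y \<in> S) x}"

text \<open>
  In the definition below, \<open>infdist\<close> agrees with the minimal distance whenever
  the set of minimizers is closed and nonempty.
\<close>

definition weak_sharp :: "'a::metric_space set \<Rightarrow> ('a \<Rightarrow> real) \<Rightarrow> bool" where
  "weak_sharp T g \<longleftrightarrow>
     (\<exists>\<alpha>>0. \<forall>t\<in>T. \<forall>ts\<in>argmin_on T g. g t - g ts \<ge> \<alpha> * infdist t (argmin_on T g))"

text \<open>
  A function that is only given on a closed convex set \<open>X\<close> (possibly with empty
  interior) is differentiated relative to \<open>X\<close>, so that no assumption concerns its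
  values elsewhere. If \<open>X\<close> has empty interior, its gradient need not be unique, and
  \<open>Dh\<close> may be any continuous choice of it. For \<open>X = UNIV\<close> this is the usual
  notion, with \<open>GDERIV h x :> Dh x\<close> for all \<open>x\<close>.
\<close>

definition C1_gradient_on :: "'a::euclidean_space set \<Rightarrow> ('a \<Rightarrow> real) \<Rightarrow> ('a \<Rightarrow> 'a) \<Rightarrow> bool" where
  "C1_gradient_on X h Dh \<longleftrightarrow>
     (\<forall>x\<in>X. (h has_derivative (\<lambda>d. d \<bullet> Dh x)) (at x within X)) \<and> continuous_on X Dh"

definition joint_gradient_scheme ::
  "'a::euclidean_space set \<Rightarrow> 'b::euclidean_space set \<Rightarrow> ('a \<Rightarrow> 'b \<Rightarrow> 'a) \<Rightarrow> ('b \<Rightarrow> 'b) \<Rightarrow>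
   (nat \<Rightarrow> real) \<Rightarrow> (nat \<Rightarrow> real) \<Rightarrow> (nat \<Rightarrow> 'a) \<Rightarrow> (nat \<Rightarrow> 'b) \<Rightarrow> bool" where
  "joint_gradient_scheme X T Df Dg \<gamma>f \<gamma>g x \<theta> \<longleftrightarrow>
     x 0 \<in> X \<and> \<theta> 0 \<in> T \<and>
     (\<forall>k. x (Suc k) = closest_point X (x k - \<gamma>f k *\<^sub>R Df (x k) (\<theta> k))) \<and>
     (\<forall>k. \<theta> (Suc k) = closest_point T (\<theta> k - \<gamma>g k *\<^sub>R Dg (\<theta> k)))"

end

(*
  Projected gradient steps whose errors e k satisfy that the sum of gamma k * norm (e k) is finite
  still converge to a minimizer: the squared distance to any minimizer is almost decreasing, and the
  weighted optimality gaps gamma k * (h (z k) - min h) are summable. Applied to g without errors,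
  this gives convergence of theta and, by weak sharpness, summability of
  gamma k * dist (theta k, Theta* ). This gives the summability of the errors that are made
  when the gradient at theta k replaces the one at a fixed point of Theta*. The limit of x cannot depend on
  that point, so it minimizes f (., theta* ) for every theta* in Theta*.
*)
theory Submission
  imports Defs
begin

text \<open>Adding the partial sums of \<open>b\<close> and subtracting those of \<open>c\<close>
  turns \<open>a\<close> into a decreasing sequence, bounded below by \<open>- suminf c\<close>. Its
  initial value bounds the partial sums of \<open>b\<close>; once both series converge, the limit of
  the corrected sequence yields one for \<open>a\<close>.\<close>

lemma almost_decreasing_convergent:
  fixes a b c :: "nat \<Rightarrow> real"
  assumes a: "\<And>k. 0 \<le> a k" and b: "\<And>k. 0 \<le> b k" and c: "\<And>k. 0 \<le> c k"
    and step: "\<And>k. a (Suc k) \<le> a k - b k + c k"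
    and summable: "summable c"
  shows "summable b" "convergent a"
proof -
  define A where "A n = a n + (\<Sum>i<n. b i) - (\<Sum>i<n. c i)" for n
  have dec: "decseq A"
    unfolding decseq_Suc_iff A_def using step by (simp add: algebra_simps)
  have c_le: "(\<Sum>i<n. c i) \<le> suminf c" for n
    using summable c by (intro sum_le_suminf) auto
  show b_sum: "summable b"
  proof (rule bounded_imp_summable[OF b])
    fix n
    have "A (Suc n) \<le> A 0" using dec by (simp add: decseq_def)
    then show "(\<Sum>i\<le>n. b i) \<le> a 0 + suminf c"
      using a[of "Suc n"] c_le[of "Suc n"] by (simp add: A_def lessThan_Suc_atMost)
  qed
  have "- suminf c \<le> A n" for n
    using a[of n] sum_nonneg[of "{..<n}" b] b c_le[of n] by (simp add: A_def)
  then obtain L where "A \<longlonglongrightarrow> L"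
    using decseq_convergent[OF dec] by blast
  then have "(\<lambda>n. A n - (\<Sum>i<n. b i) + (\<Sum>i<n. c i)) \<longlonglongrightarrow> L - suminf b + suminf c"
    by (intro tendsto_intros summable_LIMSEQ b_sum summable)
  then show "convergent a"
    by (auto simp: A_def convergent_def)
qed

text \<open>If \<open>b\<close> stayed above \<epsilon> from \<open>n\<close> on,
  \<open>\<gamma> k * b k / \<epsilon>\<close> would dominate \<open>\<gamma> k\<close> there and
  make \<gamma> summable. With \<open>b\<close> an optimality gap, this yields iterates of
  arbitrarily small gap at arbitrarily late times.\<close>

lemma frequently_small_if_weighted_summable:
  fixes \<gamma> b :: "nat \<Rightarrow> real"
  assumes \<gamma>: "\<And>k. 0 \<le> \<gamma> k" and b: "summable (\<lambda>k. \<gamma> k * b k)"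
    and div: "\<not> summable \<gamma>" and \<epsilon>: "0 < \<epsilon>"
  shows "\<exists>k\<ge>n. b k < \<epsilon>"
proof (rule ccontr)
  assume "\<not> ?thesis"
  then have ge: "\<epsilon> \<le> b k" if "k \<ge> n" for k using that by force
  have "summable \<gamma>"
  proof (rule summable_comparison_test')
    show "summable (\<lambda>k. \<gamma> k * b k / \<epsilon>)" using b by (rule summable_divide)
    show "norm (\<gamma> k) \<le> \<gamma> k * b k / \<epsilon>" if "k \<ge> n" for k
      using mult_left_mono[OF ge[OF that] \<gamma>[of k]] \<gamma>[of k] \<epsilon>
      by (simp add: field_simps)
  qed
  then show False using div by blast
qed

text \<open>Along the segment from \<open>u\<close> to \<open>v\<close>, convexity bounds every
  difference quotient at \<open>u\<close> by \<open>h v - h u\<close>, and the quotients tend to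
  \<open>h' (v - u)\<close>. The segment lies in \<open>S\<close>, so the derivative relative to
  \<open>S\<close> suffices even if \<open>S\<close> has empty interior.\<close>

lemma convex_on_above_tangent_within:
  fixes h :: "'a::real_normed_vector \<Rightarrow> real"
  assumes convex: "convex_on S h" and u: "u \<in> S" and v: "v \<in> S"
    and deriv: "(h has_derivative h') (at u within S)"
  shows "h u + h' (v - u) \<le> h v"
proof -
  have S: "convex S" using convex by (simp add: convex_on_def)
  define p where "p t = u + t *\<^sub>R (v - u)" for t :: real
  have p_eq: "p t = (1 - t) *\<^sub>R u + t *\<^sub>R v" for t
    by (simp add: p_def algebra_simps)
  have p_in: "p ` {0..1} \<subseteq> S"
    using convexD_alt[OF S u v] by (auto simp: p_eq)
  have "(p has_derivative (\<lambda>t. t *\<^sub>R (v - u))) (at 0 within {0..1})"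
    unfolding p_def by (auto intro!: derivative_eq_intros)
  moreover have "(h has_derivative h') (at (p 0) within p ` {0..1})"
    using has_derivative_subset[OF deriv p_in] by (simp add: p_def)
  ultimately have "((\<lambda>t. h (p t)) has_derivative (\<lambda>t. h' (t *\<^sub>R (v - u)))) (at 0 within {0..1})"
    by (rule has_derivative_in_compose)
  moreover have "(\<lambda>t. h' (t *\<^sub>R (v - u))) = (*) (h' (v - u))"
    using linear_scale[OF has_derivative_linear[OF deriv]] by (auto simp: fun_eq_iff)
  ultimately have "((\<lambda>t. h (p t)) has_field_derivative h' (v - u)) (at 0 within {0..1})"
    by (simp add: has_field_derivative_def)
  then have lim: "((\<lambda>t. (h (p t) - h u) / t) \<longlongrightarrow> h' (v - u)) (at 0 within {0..1})"
    by (simp add: has_field_derivative_iff p_def)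
  have "h' (v - u) \<le> h v - h u"
  proof (rule tendsto_upperbound[OF lim])
    have "(h (p t) - h u) / t \<le> h v - h u" if "0 < t" "t \<le> 1" for t
      using convex_onD[OF convex, of t u v] that u v by (simp add: p_eq field_simps)
    then show "\<forall>\<^sub>F t in at 0 within {0..1}. (h (p t) - h u) / t \<le> h v - h u"
      by (auto simp: eventually_at_filter intro!: always_eventually)
  \<comment> \<open>What remains is that the filter at 0 within the unit interval is
    nontrivial.\<close>
  qed (simp add: at_within_Icc_at_right)
  then show ?thesis by simp
qed

lemma argmin_on_iff: "x \<in> argmin_on S h \<longleftrightarrow> x \<in> S \<and> (\<forall>y\<in>S. h x \<le> h y)"
  by (auto simp: argmin_on_def is_arg_min_linorder)

text \<open>Projection is nonexpansive and fixes \<open>u\<close>, so it does not increase the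
  distance from \<open>z - w\<close> to \<open>u\<close>; the rest is expanding the square.\<close>

lemma dist_projected_step_le:
  fixes S :: "'a::euclidean_space set"
  assumes "closed S" "convex S" and u: "u \<in> S"
  shows "(dist (closest_point S (z - w)) u)\<^sup>2 \<le> (dist z u)\<^sup>2 - 2 * (w \<bullet> (z - u)) + (norm w)\<^sup>2"
proof -
  have "dist (closest_point S (z - w)) (closest_point S u) \<le> dist (z - w) u"
    using assms by (intro closest_point_lipschitz) auto
  then have "(dist (closest_point S (z - w)) u)\<^sup>2 \<le> (dist (z - w) u)\<^sup>2"
    using closest_point_self[OF u] by (simp add: power_mono)
  also have "\<dots> = (dist z u)\<^sup>2 - 2 * (w \<bullet> (z - u)) + (norm w)\<^sup>2"
    by (simp add: dist_norm power2_norm_eq_inner inner_commute algebra_simps)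
  finally show ?thesis .
qed

text \<open>A Fejer-type argument. Since \<gamma> is not summable but the weighted gaps are, the
  gaps become small along a subsequence. By compactness it has a limit point, which is a minimizer;
  the distances to that minimizer converge, hence they tend to 0.\<close>

lemma perturbed_projected_gradient:
  fixes S :: "'a::euclidean_space set" and D :: "'a \<Rightarrow> 'a"
  assumes S: "compact S" "convex S"
    and h: "convex_on S h" "C1_gradient_on S h D"
    and z0: "z 0 \<in> S"
    and step: "\<And>k. z (Suc k) = closest_point S (z k - \<gamma> k *\<^sub>R (D (z k) + e k))"
    and \<gamma>: "\<And>k. 0 \<le> \<gamma> k" "\<not> summable \<gamma>" "summable (\<lambda>k. (\<gamma> k)\<^sup>2)"
    and e: "Bseq e" "summable (\<lambda>k. \<gamma> k * norm (e k))"
  shows "\<exists>l\<in>argmin_on S h. z \<longlonglongrightarrow> l"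
    and "u \<in> argmin_on S h \<Longrightarrow> summable (\<lambda>k. \<gamma> k * (h (z k) - h u))"
proof -
  have closed: "closed S" using S by (simp add: compact_imp_closed)
  have z: "z k \<in> S" for k
    by (induction k) (use z0 closed in \<open>auto simp: step intro: closest_point_in_set\<close>)
  have h_deriv: "(h has_derivative (\<lambda>d. d \<bullet> D v)) (at v within S)" if "v \<in> S" for v
    using h that by (simp add: C1_gradient_on_def)
  have h_cont: "continuous_on S h"
    using h_deriv by (rule has_derivative_continuous_on)
  have "bounded (D ` S)"
    using h S by (simp add: C1_gradient_on_def compact_continuous_image compact_imp_bounded)
  then obtain B where B: "\<And>v. v \<in> S \<Longrightarrow> norm (D v) \<le> B"
    by (auto simp: bounded_iff)
  obtain E where E: "\<And>k. norm (e k) \<le> E"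
    using e(1) by (auto simp: Bseq_def)
  \<comment> \<open>The first term bounds twice the inner product of
    \<open>\<gamma> k *\<^sub>R e k\<close> with \<open>z k - v\<close>, the second the squared
    length of the step. Neither involves \<open>v\<close>, so one summable error serves all
    comparison points.\<close>
  define C where "C k = 2 * diameter S * (\<gamma> k * norm (e k)) + (B + E)\<^sup>2 * (\<gamma> k)\<^sup>2" for k
  have C_sum: "summable C"
    unfolding C_def by (intro summable_add summable_mult e \<gamma>)
  have C_nonneg: "0 \<le> C k" for k
    unfolding C_def using \<gamma>(1)[of k] diameter_ge_0[OF compact_imp_bounded[OF S(1)]]
    by (intro add_nonneg_nonneg mult_nonneg_nonneg) auto
  have descent:
    "(dist (z (Suc k)) v)\<^sup>2 \<le> (dist (z k) v)\<^sup>2 - 2 * (\<gamma> k * (h (z k) - h v)) + C k"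
    if v: "v \<in> S" for v k
  proof -
    have "h (z k) - h v \<le> D (z k) \<bullet> (z k - v)"
      using convex_on_above_tangent_within[OF h(1) z v h_deriv[OF z], of k]
      by (simp add: inner_commute algebra_simps)
    moreover have "- (norm (e k) * diameter S) \<le> e k \<bullet> (z k - v)"
    proof -
      have "norm (z k - v) \<le> diameter S"
        using diameter_bounded_bound[OF compact_imp_bounded[OF S(1)] z v, of k]
        by (simp add: dist_norm)
      then have "norm (e k) * norm (z k - v) \<le> norm (e k) * diameter S"
        by (simp add: mult_left_mono)
      then show ?thesis
        using Cauchy_Schwarz_ineq2[of "e k" "z k - v"] by linarith
    qed
    ultimately have "h (z k) - h v - norm (e k) * diameter S \<le> (D (z k) + e k) \<bullet> (z k - v)"
      by (simp add: inner_add_left)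
    from mult_left_mono[OF this \<gamma>(1)[of k]]
    have "\<gamma> k * (h (z k) - h v) - diameter S * (\<gamma> k * norm (e k))
        \<le> (\<gamma> k *\<^sub>R (D (z k) + e k)) \<bullet> (z k - v)"
      by (simp add: algebra_simps)
    moreover have "(norm (\<gamma> k *\<^sub>R (D (z k) + e k)))\<^sup>2 \<le> (B + E)\<^sup>2 * (\<gamma> k)\<^sup>2"
    proof -
      have "norm (D (z k) + e k) \<le> B + E"
        using B[OF z] E by (intro norm_triangle_mono)
      then have "(norm (D (z k) + e k))\<^sup>2 \<le> (B + E)\<^sup>2"
        by (simp add: power_mono)
      then show ?thesis
        by (simp add: power_mult_distrib mult.commute mult_left_mono)
    qed
    ultimately show ?thesis
      using dist_projected_step_le[OF closed S(2) v, of "z k" "\<gamma> k *\<^sub>R (D (z k) + e k)"]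
      by (simp add: step[symmetric] C_def)
  qed
  have gap_sum: "summable (\<lambda>k. \<gamma> k * (h (z k) - h v))"
    and dist_conv: "convergent (\<lambda>k. (dist (z k) v)\<^sup>2)" if v: "v \<in> argmin_on S h" for v
  proof -
    have nonneg: "0 \<le> 2 * (\<gamma> k * (h (z k) - h v))" for k
      using v z \<gamma>(1)[of k] by (simp add: argmin_on_iff)
    have "v \<in> S" using v by (simp add: argmin_on_iff)
    note * = almost_decreasing_convergent[of "\<lambda>k. (dist (z k) v)\<^sup>2",
        OF _ nonneg C_nonneg descent[OF this] C_sum]
    show "convergent (\<lambda>k. (dist (z k) v)\<^sup>2)" using * by simp
    from * have "summable (\<lambda>k. 2 * (\<gamma> k * (h (z k) - h v)))" by simp
    from summable_mult[OF this, of "1/2"] show "summable (\<lambda>k. \<gamma> k * (h (z k) - h v))" by simp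
  qed
  from gap_sum show "u \<in> argmin_on S h \<Longrightarrow> summable (\<lambda>k. \<gamma> k * (h (z k) - h u))" .
  obtain v where v: "v \<in> argmin_on S h"
    using continuous_attains_inf[OF S(1) _ h_cont] z by (auto simp: argmin_on_iff)
  \<comment> \<open>The indices \<open>r n\<close> chosen from this need not be increasing;
    \<open>r n \<ge> n\<close> is all that is retained to make them tend to infinity.\<close>
  have "\<exists>k\<ge>n. h (z k) - h v < inverse (real (Suc n))" for n
    using frequently_small_if_weighted_summable[OF \<gamma>(1) gap_sum[OF v] \<gamma>(2)] by simp
  then obtain r where r: "\<And>n. r n \<ge> n" "\<And>n. h (z (r n)) - h v < inverse (real (Suc n))"
    by metis
  obtain l s where l: "l \<in> S" and s: "strict_mono s" "(\<lambda>n. z (r (s n))) \<longlonglongrightarrow> l"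
    using S(1) z by (auto simp: compact_def o_def dest!: spec[of _ "z \<circ> r"])
  have "h l \<le> h v"
  proof (rule LIMSEQ_le)
    show "(\<lambda>n. h (z (r (s n)))) \<longlonglongrightarrow> h l"
      using continuous_on_tendsto_compose[OF h_cont s(2) l] z by simp
    show "(\<lambda>n. h v + inverse (real (Suc (s n)))) \<longlonglongrightarrow> h v"
      using LIMSEQ_subseq_LIMSEQ[OF LIMSEQ_inverse_real_of_nat_add s(1)] by (simp add: o_def)
    show "\<exists>N. \<forall>n\<ge>N. h (z (r (s n))) \<le> h v + inverse (real (Suc (s n)))"
      using r(2) by (simp add: less_imp_le algebra_simps)
  qed
  then have l_min: "l \<in> argmin_on S h"
    using l v by (force simp: argmin_on_iff)
  \<comment> \<open>As \<open>l\<close> is itself a minimizer, the squared distances to it converge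
    along the full sequence, so their limit can be read off from the subsequence.\<close>
  then obtain d where d: "(\<lambda>k. (dist (z k) l)\<^sup>2) \<longlonglongrightarrow> d"
    using dist_conv by (auto simp: convergent_def)
  have "filterlim (\<lambda>n. r (s n)) at_top sequentially"
    using r(1) seq_suble[OF s(1)] by (intro filterlim_at_top_mono[OF filterlim_ident])
      (auto intro!: always_eventually intro: order_trans)
  from filterlim_compose[OF d this] have "(\<lambda>n. (dist (z (r (s n))) l)\<^sup>2) \<longlonglongrightarrow> d" .
  moreover have "(\<lambda>n. (dist (z (r (s n))) l)\<^sup>2) \<longlonglongrightarrow> 0"
    using tendsto_power[OF s(2)[THEN tendsto_dist_iff[THEN iffD1]], of 2] by simp
  ultimately have "d = 0" by (rule LIMSEQ_unique)
  with d have "(\<lambda>k. dist (z k) l) \<longlonglongrightarrow> 0"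
    using tendsto_real_sqrt[OF d] by simp
  then have "z \<longlonglongrightarrow> l" by (simp add: tendsto_dist_iff[of z])
  with l_min show "\<exists>l\<in>argmin_on S h. z \<longlonglongrightarrow> l" by blast
qed

theorem theorem11:
  fixes X :: "(real ^ 'n) set" and \<Theta> :: "(real ^ 'm) set"
    and f :: "real ^ 'n \<Rightarrow> real ^ 'm \<Rightarrow> real" and g :: "real ^ 'm \<Rightarrow> real"
    and Df :: "real ^ 'n \<Rightarrow> real ^ 'm \<Rightarrow> real ^ 'n" and Dg :: "real ^ 'm \<Rightarrow> real ^ 'm"
    and Gfx Gg Gf\<theta> Mf\<theta> :: real
    and \<gamma>f \<gamma>g :: "nat \<Rightarrow> real"
    and x :: "nat \<Rightarrow> real ^ 'n" and \<theta> :: "nat \<Rightarrow> real ^ 'm"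
  assumes "X \<noteq> {}" "closed X" "convex X" "compact X"
    and "\<Theta> \<noteq> {}" "closed \<Theta>" "convex \<Theta>" "compact \<Theta>"
    and f_convex: "\<And>t. t \<in> \<Theta> \<Longrightarrow> convex_on X (\<lambda>u. f u t)"
    and g_convex: "convex_on UNIV g"
    and f_C1: "\<And>t. t \<in> \<Theta> \<Longrightarrow> C1_gradient_on X (\<lambda>u. f u t) (\<lambda>u. Df u t)"
    and g_C1: "C1_gradient_on UNIV g Dg"
    and Df_lipschitz_x: "\<And>u v t. u \<in> X \<Longrightarrow> v \<in> X \<Longrightarrow> t \<in> \<Theta> \<Longrightarrow>
          norm (Df u t - Df v t) \<le> Gfx * norm (u - v)"
    and Dg_lipschitz: "Gg-lipschitz_on \<Theta> Dg"
    and Df_lipschitz_\<theta>: "\<And>u s t. u \<in> X \<Longrightarrow> s \<in> \<Theta> \<Longrightarrow> t \<in> \<Theta> \<Longrightarrow>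
          norm (Df u s - Df u t) \<le> Gf\<theta> * norm (s - t)"
    and g_weak_sharp: "weak_sharp \<Theta> g"
    and Df_dist: "\<And>u t ts. u \<in> X \<Longrightarrow> t \<in> \<Theta> \<Longrightarrow> ts \<in> argmin_on \<Theta> g \<Longrightarrow>
          norm (Df u t - Df u ts) \<le> Mf\<theta> * infdist t (argmin_on \<Theta> g)"
    and \<gamma>g_nonneg: "\<And>k. \<gamma>g k \<ge> 0"
    and \<gamma>g_diminishing: "\<gamma>g \<longlonglongrightarrow> 0"
    and \<gamma>g_sum: "filterlim (\<lambda>N. \<Sum>k=1..N. \<gamma>g k) at_top sequentially"
    and \<gamma>g_sum_squares: "summable (\<lambda>k. (\<gamma>g (Suc k))\<^sup>2)"
    and \<gamma>f_eq: "\<And>k. k > 0 \<Longrightarrow> \<gamma>f k = \<gamma>g k"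
    and scheme: "joint_gradient_scheme X \<Theta> Df Dg \<gamma>f \<gamma>g x \<theta>"
  shows "(\<exists>xs. x \<longlonglongrightarrow> xs \<and> (\<forall>ts\<in>argmin_on \<Theta> g. xs \<in> argmin_on X (\<lambda>u. f u ts))) \<and>
         (\<exists>ts\<in>argmin_on \<Theta> g. \<theta> \<longlonglongrightarrow> ts)"
proof -
  \<comment> \<open>Shifted by one, because \<open>\<gamma>f 0\<close> may differ from \<open>\<gamma>g 0\<close>.\<close>
  define \<gamma> where "\<gamma> k = \<gamma>g (Suc k)" for k
  define y where "y k = x (Suc k)" for k
  define \<tau> where "\<tau> k = \<theta> (Suc k)" for k
  have \<gamma>_nonneg: "0 \<le> \<gamma> k" for k by (simp add: \<gamma>_def \<gamma>g_nonneg)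
  have \<gamma>_sq: "summable (\<lambda>k. (\<gamma> k)\<^sup>2)" using \<gamma>g_sum_squares by (simp add: \<gamma>_def)
  have \<gamma>_div: "\<not> summable \<gamma>"
  proof
    assume "summable \<gamma>"
    then have "(\<lambda>n. \<Sum>k<n. \<gamma> k) \<longlonglongrightarrow> suminf \<gamma>" by (rule summable_LIMSEQ)
    \<comment> \<open>The shift in \<gamma> matches the summation in the hypothesis, which starts at
      1.\<close>
    moreover have "(\<Sum>k<n. \<gamma> k) = (\<Sum>k=1..n. \<gamma>g k)" for n
      unfolding \<gamma>_def by (simp add: sum.atLeast1_atMost_eq)
    ultimately show False
      using \<gamma>g_sum not_tendsto_and_filterlim_at_infinity[OF sequentially_bot]
        filterlim_at_top_imp_at_infinity by auto
  qed
  have y_step: "y (Suc k) = closest_point X (y k - \<gamma> k *\<^sub>R Df (y k) (\<tau> k))"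
    and \<tau>_step: "\<tau> (Suc k) = closest_point \<Theta> (\<tau> k - \<gamma> k *\<^sub>R Dg (\<tau> k))" for k
    using scheme \<gamma>f_eq by (auto simp: joint_gradient_scheme_def y_def \<tau>_def \<gamma>_def)
  have y: "y k \<in> X" for k
    using scheme assms(1,2) by (simp add: joint_gradient_scheme_def y_def closest_point_in_set)
  have \<tau>: "\<tau> k \<in> \<Theta>" for k
    using scheme assms(5,6) by (simp add: joint_gradient_scheme_def \<tau>_def closest_point_in_set)
  have g: "convex_on \<Theta> g" "C1_gradient_on \<Theta> g Dg"
    using g_convex g_C1 \<open>convex \<Theta>\<close>
    by (auto simp: C1_gradient_on_def convex_on_def
        intro: has_derivative_at_withinI continuous_on_subset)
  note g_descent = perturbed_projected_gradient[where z = \<tau> and e = "\<lambda>_. 0",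
      OF \<open>compact \<Theta>\<close> \<open>convex \<Theta>\<close> g \<tau> _ \<gamma>_nonneg \<gamma>_div \<gamma>_sq]
  obtain t where t: "t \<in> argmin_on \<Theta> g" and \<tau>_lim: "\<tau> \<longlonglongrightarrow> t"
    using g_descent(1) \<tau>_step by auto
  have dist_sum: "summable (\<lambda>k. \<gamma> k * infdist (\<tau> k) (argmin_on \<Theta> g))"
  proof -
    obtain \<alpha> where "\<alpha> > 0"
      and \<alpha>: "\<And>s. s \<in> \<Theta> \<Longrightarrow> \<alpha> * infdist s (argmin_on \<Theta> g) \<le> g s - g t"
      using g_weak_sharp t unfolding weak_sharp_def by blast
    have "summable (\<lambda>k. \<gamma> k * (g (\<tau> k) - g t))"
      using g_descent(2)[OF _ _ _ t] \<tau>_step by simp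
    from summable_divide[OF this, of \<alpha>] show ?thesis
    proof (rule summable_comparison_test'[where N = 0])
      fix k
      show "norm (\<gamma> k * infdist (\<tau> k) (argmin_on \<Theta> g)) \<le> \<gamma> k * (g (\<tau> k) - g t) / \<alpha>"
        using mult_left_mono[OF \<alpha>[OF \<tau>] \<gamma>_nonneg, of k] \<open>\<alpha> > 0\<close> \<gamma>_nonneg[of k]
        by (simp add: field_simps infdist_nonneg)
    qed
  qed
  have x_lim: "\<exists>l\<in>argmin_on X (\<lambda>u. f u s). y \<longlonglongrightarrow> l" if s: "s \<in> argmin_on \<Theta> g" for s
  proof -
    have s\<Theta>: "s \<in> \<Theta>" using s by (simp add: argmin_on_iff)
    \<comment> \<open>With this error the direction \<open>Df (y k) (\<tau> k)\<close> is the
      gradient of \<open>f\<close> at the fixed parameter \<open>s\<close> plus \<open>e k\<close>.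
      Lipschitz continuity in the parameter and compactness of \<Theta> bound \<open>e\<close>; the
      distance estimate \<open>Df_dist\<close> makes it summable against \<gamma>.\<close>
    define e where "e k = Df (y k) (\<tau> k) - Df (y k) s" for k
    have "Bseq e"
    proof (rule BseqI')
      fix k
      \<comment> \<open>The absolute value appears because no sign of \<open>Gf\<theta>\<close> is
        assumed, while the next step multiplies an inequality by this factor.\<close>
      have "norm (e k) \<le> \<bar>Gf\<theta>\<bar> * norm (\<tau> k - s)"
        using Df_lipschitz_\<theta>[OF y \<tau> s\<Theta>, of k k] mult_right_mono[OF abs_ge_self norm_ge_zero]
        by (fastforce simp: e_def intro: order_trans)
      also have "\<dots> \<le> \<bar>Gf\<theta>\<bar> * diameter \<Theta>"
        using diameter_bounded_bound[OF compact_imp_bounded[OF \<open>compact \<Theta>\<close>] \<tau> s\<Theta>, of k]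
        by (simp add: dist_norm mult_left_mono)
      finally show "norm (e k) \<le> \<bar>Gf\<theta>\<bar> * diameter \<Theta>" .
    qed
    moreover have "summable (\<lambda>k. \<gamma> k * norm (e k))"
    proof (rule summable_comparison_test'[OF summable_mult[OF dist_sum, of Mf\<theta>], where N = 0])
      fix k
      show "norm (\<gamma> k * norm (e k)) \<le> Mf\<theta> * (\<gamma> k * infdist (\<tau> k) (argmin_on \<Theta> g))"
        using mult_left_mono[OF Df_dist[OF y \<tau> s] \<gamma>_nonneg, of k k k] \<gamma>_nonneg[of k]
        by (simp add: e_def mult_ac)
    qed
    ultimately show ?thesis
      using perturbed_projected_gradient(1)[where z = y and e = e,
          OF \<open>compact X\<close> \<open>convex X\<close> f_convex[OF s\<Theta>] f_C1[OF s\<Theta>] y] y_step \<gamma>_nonneg \<gamma>_div \<gamma>_sq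
      by (simp add: e_def)
  qed
  obtain xs where xs: "y \<longlonglongrightarrow> xs" using x_lim[OF t] by blast
  \<comment> \<open>The sequence \<open>y\<close> does not involve \<open>s\<close>, so the
    minimizer that \<open>x_lim\<close> yields for each \<open>s\<close> is the same limit
    \<open>xs\<close>.\<close>
  have "xs \<in> argmin_on X (\<lambda>u. f u s)" if "s \<in> argmin_on \<Theta> g" for s
    using x_lim[OF that] LIMSEQ_unique[OF xs] by blast
  moreover have "x \<longlonglongrightarrow> xs" "\<theta> \<longlonglongrightarrow> t"
    using xs \<tau>_lim unfolding y_def \<tau>_def by (simp_all add: filterlim_sequentially_Suc)
  ultimately show ?thesis using t by blast
qed

end
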